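(* For any positive integers $\alpha,\beta,m,n,r$, we have $$\sum_{k=0}^{n-1}\left[(k)_{\beta}(k+\beta+1)_{\beta}\right]^r\,[2(k+\beta)]\,q^{(n-2\beta-k)(2\beta\alpha m+1)}\prod_{i=0}^{2\beta-1}\left(w_{k+i}^{(\alpha)}(x;q)\right)^m\equiv 0\pmod{[n]},$$ where the congruence is in the ring $\mathbb{Z}[q,q^{-1}][x]$.
   Context: Here $q$ and $x$ are indeterminates. $(y)_0=1$ and $(y)_N=y(y+1)\cdots(y+N-1)$ for $N\ge1$ is the rising factorial. For an integer $N$, $[N]=\frac{1-q^N}{1-q}$ is the $q$-integer, an element of $\mathbb{Z}[q,q^{-1}]$; in particular $[(k)_{\beta}(k+\beta+1)_{\beta}]$ is the $q$-integer of the number $(k)_\beta(k+\beta+1)_\beta$. For nonnegative integers $N$ and integers $k$, $\left[\begin{matrix} N \\ k \end{matrix}\right]=\frac{\prod_{1\le j\le k}[N-j+1]}{\prod_{1\le j\le k}[j]}$ is the $q$-binomial coefficient, equal to $1$ if $k=0$ and to $0$ if $k<0$ or $k>N$. For a nonnegative integer $k$ and a positive integer $\alpha$, $$w_k^{(\alpha)}(x;q)=\sum_{j=1}^{k}q^{\alpha\left(\binom{j+1}{2}-(k+1)(j-1)\right)}\left(\left[\begin{matrix} k-1 \\ j-1 \end{matrix}\right]\left[\begin{matrix} k+j \\ j \end{matrix}\right]-\left[\begin{matrix} k \\ j \end{matrix}\right]\left[\begin{matrix} k+j \\ j-1 \end{matrix}\right]\right)^{\alpha}x^{j-1}\in\mathbb{Z}[q,q^{-1}][x],$$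 with $w_0^{(\alpha)}(x;q)=0$ (empty sum). A congruence $A\equiv 0\pmod{P(q)}$ means that $P(q)$ divides $A$ in $\mathbb{Z}[q,q^{-1}][x]$. *)

theory Defs
  imports "HOL-Library.Poly_Mapping" "HOL-Computational_Algebra.Polynomial"
begin

text \<open>
  The ring of Laurent polynomials in \<open>q\<close> over the integers is the group ring of the additive
  group of integers: a finitely supported map sends each exponent to its coefficient, and the
  product is convolution. Polynomials in \<open>x\<close> over it are elements of the type
  \<open>laurent poly\<close>, so \<open>dvd\<close> on that type is divisibility in the ring of the congruences.
  (In the ring of formal Laurent series every nonzero \<open>q\<close>-integer would be a unit.)
\<close>

type_synonym laurent = "int \<Rightarrow>\<^sub>0 int"

definition qpow :: "int \<Rightarrow> laurent" where
  "qpow e = Poly_Mapping.single e 1"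

text \<open>
  The quotient \<open>a / b\<close>, for nonzero \<open>b\<close> dividing \<open>a\<close>; it is unique because Laurent polynomials
  form an integral domain.
\<close>

definition exact_quot :: "laurent \<Rightarrow> laurent \<Rightarrow> laurent" where
  "exact_quot a b = (THE c. c * b = a)"

definition qint :: "int \<Rightarrow> laurent" where
  "qint N = exact_quot (1 - qpow N) (1 - qpow 1)"

text \<open>
  For \<open>k > N\<close> the numerator contains the factor \<open>qint 0 = 0\<close>.
\<close>

definition qbinom :: "nat \<Rightarrow> int \<Rightarrow> laurent" where
  "qbinom N k =
     (if k < 0 then 0
      else exact_quot (\<Prod>j\<in>{1..k}. qint (int N - j + 1)) (\<Prod>j\<in>{1..k}. qint j))"

definition w :: "nat \<Rightarrow> nat \<Rightarrow> laurent poly" where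
  "w \<alpha> k =
     (\<Sum>j=1..k. monom
        (qpow (int \<alpha> * (int (Suc j choose 2) - (int k + 1) * (int j - 1)))
         * (qbinom (k - 1) (int j - 1) * qbinom (k + j) (int j)
            - qbinom k (int j) * qbinom (k + j) (int j - 1)) ^ \<alpha>)
        (j - 1))"

lemma qpow_0 [simp]: "qpow 0 = 1"
  by (simp add: qpow_def)

lemma qpow_add: "qpow (a + b) = qpow a * qpow b"
  by (simp add: qpow_def mult_single)

lemma qpow_eq_iff [simp]: "qpow a = qpow b \<longleftrightarrow> a = b"
proof
  assume "qpow a = qpow b"
  then have "Poly_Mapping.lookup (qpow a) a = Poly_Mapping.lookup (qpow b) a" by simp
  then show "a = b" by (auto simp: qpow_def lookup_single when_def split: if_splits)
qed simp

lemma qpow_eq_1_iff [simp]: "qpow a = 1 \<longleftrightarrow> a = 0"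
  using qpow_eq_iff[of a 0] by (simp del: qpow_eq_iff)

lemma exact_quot_eqI:
  assumes "b \<noteq> 0" and "c * b = a"
  shows "exact_quot a b = c"
  unfolding exact_quot_def using assms by (intro the_equality) auto

lemma exact_quot_mult:
  assumes "b \<noteq> 0" and "b dvd a"
  shows "exact_quot a b * b = a"
proof -
  obtain c where "a = b * c" using assms(2) by (elim dvdE)
  then show ?thesis using exact_quot_eqI[OF assms(1), of c a] by (simp add: mult.commute)
qed

lemma one_minus_q_nonzero: "1 - qpow 1 \<noteq> 0"
  using qpow_eq_1_iff[of 1] by (metis eq_iff_diff_eq_0 zero_neq_one)

lemma one_minus_q_dvd: "1 - qpow 1 dvd 1 - qpow N"
proof -
  have nn: "1 - qpow 1 dvd 1 - qpow (int n)" for n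
  proof (induction n)
    case (Suc n)
    have "1 - qpow (int (Suc n)) = (1 - qpow (int n)) + qpow (int n) * (1 - qpow 1)"
      by (simp add: algebra_simps flip: qpow_add)
    moreover have "1 - qpow 1 dvd qpow (int n) * (1 - qpow 1)" by (rule dvd_triv_right)
    ultimately show ?case using Suc by (metis dvd_add)
  qed simp
  show ?thesis
  proof (cases "N \<ge> 0")
    case True
    then show ?thesis using nn[of "nat N"] by simp
  next
    case False
    have "1 - qpow N = - qpow N * (1 - qpow (- N))"
      by (simp add: algebra_simps flip: qpow_add)
    moreover have "1 - qpow 1 dvd 1 - qpow (- N)" using nn[of "nat (- N)"] False by simp
    ultimately show ?thesis by (metis dvd_mult)
  qed
qed

lemma qint_mult: "qint N * (1 - qpow 1) = 1 - qpow N"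
  unfolding qint_def by (rule exact_quot_mult[OF one_minus_q_nonzero one_minus_q_dvd])

lemma qint_eqI: "c * (1 - qpow 1) = 1 - qpow N \<Longrightarrow> qint N = c"
  unfolding qint_def by (rule exact_quot_eqI[OF one_minus_q_nonzero])

lemma qint_0 [simp]: "qint 0 = 0"
  by (rule qint_eqI) simp

lemma qint_eq_0_iff [simp]: "qint N = 0 \<longleftrightarrow> N = 0"
proof
  assume "qint N = 0"
  then have "qpow N = 1" using qint_mult[of N] by simp
  then show "N = 0" by simp
qed simp

lemma qint_of_nat: "qint (int n) = (\<Sum>i<n. qpow (int i))"
proof (rule qint_eqI)
  show "(\<Sum>i<n. qpow (int i)) * (1 - qpow 1) = 1 - qpow (int n)"
  proof (induction n)
    case (Suc n)
    have "qpow (int n) * (1 - qpow 1) = qpow (int n) - qpow (int (Suc n))"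
      by (simp add: algebra_simps flip: qpow_add)
    then show ?case using Suc by (simp only: sum.lessThan_Suc distrib_right) simp
  qed simp
qed

lemma qint_add: "qint (a + b) = qint a + qpow a * qint b"
proof (rule qint_eqI)
  have "(qint a + qpow a * qint b) * (1 - qpow 1)
      = qint a * (1 - qpow 1) + qpow a * (qint b * (1 - qpow 1))"
    by (simp only: distrib_right mult.assoc)
  then show "(qint a + qpow a * qint b) * (1 - qpow 1) = 1 - qpow (a + b)"
    unfolding qint_mult by (simp add: right_diff_distrib qpow_add)
qed

lemma atLeastAtMost_1_int_Suc: "{1..int (Suc k)} = insert (int k + 1) {1..int k}"
  by auto

lemma qbinom_numerator_Suc:
  "(\<Prod>j\<in>{1..int (Suc k)}. qint (int (Suc N) - j + 1))
     = qint (int N + 1) * (\<Prod>j\<in>{1..int k}. qint (int N - j + 1))"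
  by (induction k) (simp_all add: atLeastAtMost_1_int_Suc algebra_simps del: of_nat_Suc, simp_all)

lemma qbinom_denominator_dvd:
  "(\<Prod>j\<in>{1..int k}. qint j) dvd (\<Prod>j\<in>{1..int k}. qint (int N - j + 1))"
proof (induction N arbitrary: k)
  case 0
  show ?case
  proof (cases "k = 0")
    case False
    then have "(1::int) \<in> {1..int k}" by simp
    then have "(\<Prod>j\<in>{1..int k}. qint (int 0 - j + 1)) = 0"
      by (intro prod_zero) (auto intro!: bexI[of _ 1])
    then show ?thesis by (metis dvd_0_right)
  qed simp
next
  case (Suc N)
  show ?case
  proof (cases k)
    case (Suc l)
    let ?P = "\<Prod>j\<in>{1..int l}. qint (int N - j + 1)"
    let ?F = "\<lambda>l. \<Prod>j\<in>{1..int l}. qint j"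
    have F: "?F (Suc l) = qint (int l + 1) * ?F l"
      by (simp only: atLeastAtMost_1_int_Suc) simp
    have P: "(\<Prod>j\<in>{1..int (Suc l)}. qint (int N - j + 1)) = qint (int N - int l) * ?P"
      by (simp only: atLeastAtMost_1_int_Suc) simp
    have "qint (int N + 1) = qint (int l + 1) + qpow (int l + 1) * qint (int N - int l)"
      using qint_add[of "int l + 1" "int N - int l"] by (simp add: algebra_simps)
    then have "(\<Prod>j\<in>{1..int (Suc l)}. qint (int (Suc N) - j + 1))
        = qint (int l + 1) * ?P + qpow (int l + 1) * (\<Prod>j\<in>{1..int (Suc l)}. qint (int N - j + 1))"
      unfolding qbinom_numerator_Suc P by (simp add: algebra_simps)
    moreover have "?F (Suc l) dvd qint (int l + 1) * ?P"
      unfolding F by (intro mult_dvd_mono Suc.IH dvd_refl)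
    moreover have "?F (Suc l) dvd qpow (int l + 1) * (\<Prod>j\<in>{1..int (Suc l)}. qint (int N - j + 1))"
      by (intro dvd_mult Suc.IH)
    ultimately show ?thesis unfolding Suc by (metis dvd_add)
  qed simp
qed

lemma qbinom_mult:
  assumes "k \<ge> 0"
  shows "qbinom N k * (\<Prod>j\<in>{1..k}. qint j) = (\<Prod>j\<in>{1..k}. qint (int N - j + 1))"
proof -
  have "(\<Prod>j\<in>{1..k}. qint j) \<noteq> 0" by auto
  then show ?thesis
    using assms qbinom_denominator_dvd[of "nat k" N] by (simp add: qbinom_def exact_quot_mult)
qed

lemma qbinom_0 [simp]: "qbinom N 0 = 1"
  using qbinom_mult[of 0 N] by simp

lemma qbinom_eq_0: "k < 0 \<or> k > int N \<Longrightarrow> qbinom N k = 0"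
proof (cases "k < 0")
  case False
  assume "k < 0 \<or> k > int N"
  with False have "(\<Prod>j\<in>{1..k}. qint (int N - j + 1)) = 0"
    by (intro prod_zero) (auto intro!: bexI[of _ "int N + 1"])
  then have "qbinom N k * (\<Prod>j\<in>{1..k}. qint j) = 0"
    using qbinom_mult[of k N] False by simp
  moreover have "(\<Prod>j\<in>{1..k}. qint j) \<noteq> 0" by auto
  ultimately show ?thesis by simp
qed (simp add: qbinom_def)

lemma w_0 [simp]: "w \<alpha> 0 = 0"
  by (simp add: w_def)

end

theory Submission
  imports Defs Complex_Main "HOL-Number_Theory.Cong"
begin

text \<open>
  Since \<open>[n]\<close> has the nontrivial \<open>n\<close>-th roots of unity as its simple zeros, it suffices that every
  coefficient of the sum vanishes at each such root \<open>\<zeta>\<close>, of order \<open>d > 1\<close> say, \<open>d\<close> dividing \<open>n\<close>.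
  At \<open>q = \<zeta>\<close> the summand is zero unless \<open>k, \<dots>, k + 2\<beta>\<close> all avoid the multiples of \<open>d\<close>,
  because otherwise one of the factors \<open>[(k)\<^sub>\<beta> (k+\<beta>+1)\<^sub>\<beta>]\<close>, \<open>[2(k+\<beta>)]\<close> vanishes. The remaining
  \<open>k\<close> are permuted by the involution \<open>ad + b \<mapsto> ad + (d - 2\<beta> - b)\<close>, and the summand changes
  sign under it. This rests on the reflection \<open>w\<^bsub>k'\<^esub> = \<zeta>\<^bsup>-\<alpha>(2k+1)\<^esup> w\<^bsub>k\<^esub>\<close> for \<open>k = ad + b\<close>,
  \<open>k' = ad + (d - 1 - b)\<close> with \<open>1 \<le> b \<le> d - 2\<close>, a \<open>q\<close>-analogue of the symmetry of the coefficients
  of \<open>w\<^bsub>k\<^esub>\<close>, as polynomials in \<open>k\<close>, under \<open>k \<mapsto> -1-k\<close>. As the denominators of these polynomials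
  may vanish at \<open>\<zeta>\<close>, the \<open>q\<close>-Lucas theorem first reduces the coefficients to residues modulo \<open>d\<close>.
\<close>

section \<open>Evaluation of Laurent polynomials\<close>

text \<open>Substitution of \<open>z\<close> for \<open>q\<close>. Negative exponents occur, so it
  is multiplicative only for \<open>z \<noteq> 0\<close>: at \<open>z = 0\<close> both
  \<open>q\<close> and its inverse are sent to 0.\<close>

definition ev :: "complex \<Rightarrow> laurent \<Rightarrow> complex" where
  "ev z p = (\<Sum>e\<in>Poly_Mapping.keys p. of_int (Poly_Mapping.lookup p e) * z powi e)"

lemma ev_superset:
  assumes "finite A" "Poly_Mapping.keys p \<subseteq> A"
  shows "ev z p = (\<Sum>e\<in>A. of_int (Poly_Mapping.lookup p e) * z powi e)"
  unfolding ev_def using assms by (intro sum.mono_neutral_left) (auto simp: in_keys_iff)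

lemma ev_single [simp]: "ev z (Poly_Mapping.single e c) = of_int c * z powi e"
  by (subst ev_superset[of "{e}"]) auto

lemma ev_0 [simp]: "ev z 0 = 0"
  by (simp add: ev_def)

lemma ev_qpow [simp]: "ev z (qpow e) = z powi e"
  by (simp add: qpow_def)

lemma ev_1 [simp]: "ev z 1 = 1"
  using ev_qpow[of z 0] by simp

lemma ev_add [simp]: "ev z (p + q) = ev z p + ev z q"
proof -
  let ?A = "Poly_Mapping.keys p \<union> Poly_Mapping.keys q"
  have "Poly_Mapping.keys (p + q) \<subseteq> ?A" by (rule keys_add)
  then have "ev z (p + q) = (\<Sum>e\<in>?A. of_int (Poly_Mapping.lookup (p + q) e) * z powi e)"
    by (intro ev_superset) auto
  also have "\<dots> = ev z p + ev z q"
    by (simp add: ev_superset[of ?A] lookup_add distrib_right sum.distrib)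
  finally show ?thesis .
qed

lemma ev_uminus [simp]: "ev z (- p) = - ev z p"
  using ev_add[of z p "- p"] by (simp add: eq_neg_iff_add_eq_0 add.commute)

lemma ev_diff [simp]: "ev z (p - q) = ev z p - ev z q"
  using ev_add[of z p "- q"] by simp

lemma ev_sum [simp]: "ev z (sum f A) = (\<Sum>i\<in>A. ev z (f i))"
  by (induction A rule: infinite_finite_induct) auto

lemma poly_mapping_sum_monomials:
  "(\<Sum>e\<in>Poly_Mapping.keys p. Poly_Mapping.single e (Poly_Mapping.lookup p e)) = p"
  by (rule poly_mapping_eqI) (simp add: lookup_sum lookup_single when_def in_keys_iff)

lemma ev_mult [simp]:
  assumes "z \<noteq> 0"
  shows "ev z (p * q) = ev z p * ev z q"
proof -
  \<comment> \<open>Both factors are split into monomials, so that the convolution becomes a product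
    of two finite sums.\<close>
  have "p * q = (\<Sum>e\<in>Poly_Mapping.keys p. Poly_Mapping.single e (Poly_Mapping.lookup p e))
      * (\<Sum>e\<in>Poly_Mapping.keys q. Poly_Mapping.single e (Poly_Mapping.lookup q e))"
    by (simp only: poly_mapping_sum_monomials)
  also have "ev z \<dots> = ev z p * ev z q"
    by (simp add: sum_product mult_single ev_def[of z p] ev_def[of z q] assms power_int_add mult_ac)
  finally show ?thesis .
qed

lemma ev_power [simp]: "z \<noteq> 0 \<Longrightarrow> ev z (p ^ k) = ev z p ^ k"
  by (induction k) auto

section \<open>Divisibility by \<open>qint n\<close> and vanishing at roots of unity\<close>

lemma qint_dvd_one_minus_qpow: "qint (int n) dvd 1 - qpow (int n * t)"
proof -
  have nn: "qint (int n) dvd 1 - qpow (int n * int k)" for k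
  proof (induction k)
    case (Suc k)
    \<comment> \<open>\<open>[n]\<close> enters through
      \<open>1 - q^n = [n] (1 - q)\<close>.\<close>
    have "1 - qpow (int n * int (Suc k))
        = (1 - qpow (int n * int k)) + qpow (int n * int k) * (qint (int n) * (1 - qpow 1))"
      unfolding qint_mult by (simp add: algebra_simps flip: qpow_add)
    then show ?case using Suc by (metis dvd_add dvd_mult dvd_triv_left)
  qed simp
  show ?thesis
  proof (cases "t \<ge> 0")
    case True
    then show ?thesis using nn[of "nat t"] by simp
  next
    case False
    have "1 - qpow (int n * t) = - qpow (int n * t) * (1 - qpow (int n * - t))"
      by (simp add: algebra_simps flip: qpow_add)
    moreover have "qint (int n) dvd 1 - qpow (int n * - t)" using nn[of "nat (- t)"] False by simp
    ultimately show ?thesis by (metis dvd_mult)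
  qed
qed

text \<open>The \<open>n - 1\<close> nontrivial \<open>n\<close>-th roots of unity are distinct
  zeros, more than the degree allows. The alternative \<open>p = 0\<close> covers
  \<open>n = 1\<close>, where no degree is below \<open>n - 1\<close>.\<close>

lemma complex_poly_vanishing_at_roots_of_unity:
  fixes p :: "complex poly"
  assumes "n > 0" and "degree p < n - 1 \<or> p = 0"
    and "\<And>z. z ^ n = 1 \<Longrightarrow> z \<noteq> 1 \<Longrightarrow> poly p z = 0"
  shows "p = 0"
proof (rule ccontr)
  assume "p \<noteq> 0"
  have "card {z::complex. z ^ n = 1} = n"
    using card_roots_unity_eq[of n] assms(1) by simp
  then have "card ({z::complex. z ^ n = 1} - {1}) = n - 1"
    using assms(1) by (subst card_Diff_singleton) auto
  moreover have "card ({z::complex. z ^ n = 1} - {1}) \<le> card {z. poly p z = 0}"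
    using assms(3) poly_roots_finite[OF \<open>p \<noteq> 0\<close>] by (intro card_mono) auto
  moreover have "card {z. poly p z = 0} \<le> degree p"
    using \<open>p \<noteq> 0\<close> by (rule card_poly_roots_bound)
  ultimately show False using assms(2) \<open>p \<noteq> 0\<close> by simp
qed

text \<open>
  Reducing exponents modulo \<open>n\<close> gives a Laurent polynomial with exponents below \<open>n\<close>; subtracting a
  multiple of \<open>[n]\<close> from it kills the top coefficient, and the rest has too many zeros.
\<close>

lemma qint_dvd_if_vanishing:
  assumes "n > 0" and vanish: "\<And>z::complex. z ^ n = 1 \<Longrightarrow> z \<noteq> 1 \<Longrightarrow> ev z c = 0"
  shows "qint (int n) dvd c"
proof -
  let ?c = "Poly_Mapping.lookup c"
  define R where "R = (\<Sum>e\<in>Poly_Mapping.keys c. Poly_Mapping.single (e mod int n) (?c e))"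
  define v where "v = Poly_Mapping.lookup R (int n - 1)"
  define S where "S = (\<Sum>i<n. Poly_Mapping.single (int i) v)"
  have cR: "c - R = (\<Sum>e\<in>Poly_Mapping.keys c. Poly_Mapping.single (e mod int n) (?c e)
      * - (1 - qpow (int n * (e div int n))))"
  proof -
    have "c - R = (\<Sum>e\<in>Poly_Mapping.keys c. Poly_Mapping.single e (?c e)
        - Poly_Mapping.single (e mod int n) (?c e))"
      by (simp add: R_def sum_subtractf poly_mapping_sum_monomials)
    also have "\<dots> = (\<Sum>e\<in>Poly_Mapping.keys c. Poly_Mapping.single (e mod int n) (?c e)
        * - (1 - qpow (int n * (e div int n))))"
      by (intro sum.cong refl) (simp add: algebra_simps qpow_def mult_single)
    finally show ?thesis .
  qed
  have "qint (int n) dvd c - R"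
    unfolding cR by (intro dvd_sum dvd_mult) (metis dvd_minus_iff qint_dvd_one_minus_qpow)
  have S: "S = Poly_Mapping.single 0 v * qint (int n)"
    by (simp add: S_def qint_of_nat sum_distrib_left qpow_def mult_single)
  have "Poly_Mapping.keys R \<subseteq> {0..<int n}"
  proof -
    have "Poly_Mapping.keys R
        \<subseteq> (\<Union>e\<in>Poly_Mapping.keys c. Poly_Mapping.keys (Poly_Mapping.single (e mod int n) (?c e)))"
      unfolding R_def by (rule Poly_Mapping.keys_sum)
    also have "\<dots> \<subseteq> {0..<int n}" using assms(1) by auto
    finally show ?thesis .
  qed
  then have R0: "Poly_Mapping.lookup R e = 0" if "e \<notin> {0..<int n}" for e
    using that by (auto simp: in_keys_iff)
  have evR: "ev z R = (\<Sum>i<n. of_int (Poly_Mapping.lookup R (int i)) * z ^ i)" for z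
  proof -
    have "{0..<int n} = int ` {..<n}"
      by (auto simp: image_iff intro!: bexI[of _ "nat _"])
    then have "ev z R = (\<Sum>e\<in>int ` {..<n}. of_int (Poly_Mapping.lookup R e) * z powi e)"
      using \<open>Poly_Mapping.keys R \<subseteq> _\<close> by (intro ev_superset) auto
    then show ?thesis by (simp add: sum.reindex)
  qed
  \<comment> \<open>\<open>p\<close> is \<open>R - S\<close> over the complex numbers; the choice of
    \<open>v\<close> removes its coefficient of index \<open>n - 1\<close>.\<close>
  define p :: "complex poly" where
    "p = (\<Sum>i<n. monom (of_int (Poly_Mapping.lookup R (int i) - v)) i)"
  have coeff_p: "coeff p i = (if i < n then of_int (Poly_Mapping.lookup R (int i) - v) else 0)" for i
    by (simp add: p_def coeff_sum)
  have "p = 0"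
  proof (rule complex_poly_vanishing_at_roots_of_unity[OF assms(1)])
    have "coeff p i = 0" if "i \<ge> n - 1" for i
      using that assms(1) by (cases "i = n - 1") (auto simp: coeff_p v_def of_nat_diff)
    then show "degree p < n - 1 \<or> p = 0"
      by (metis leading_coeff_0_iff not_less)
  next
    fix z :: complex assume z: "z ^ n = 1" "z \<noteq> 1"
    then have "z \<noteq> 0" using assms(1) by (auto simp: power_0_left)
    have "z powi e = z powi (e mod int n)" for e
    proof -
      have "z powi e = z powi (int n * (e div int n) + e mod int n)" by simp
      also have "\<dots> = z powi (e mod int n)"
        using \<open>z \<noteq> 0\<close> z(1) by (subst power_int_add) (auto simp: power_int_mult)
      finally show ?thesis .
    qed
    then have "ev z R = ev z c"
      by (simp add: R_def ev_def[of z c])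
    then have "ev z R = 0" using vanish z by simp
    moreover have "(\<Sum>i<n. z ^ i) = 0"
      using z by (simp add: sum_gp_strict)
    moreover have "poly p z = ev z R - of_int v * (\<Sum>i<n. z ^ i)"
      by (simp add: p_def poly_sum poly_monom evR sum_distrib_left left_diff_distrib sum_subtractf)
    ultimately show "poly p z = 0" by simp
  qed
  have "R = S"
  proof (rule poly_mapping_eqI)
    fix e
    show "Poly_Mapping.lookup R e = Poly_Mapping.lookup S e"
    proof (cases "e \<in> {0..<int n}")
      case True
      then obtain i where i: "e = int i" "i < n" by (metis atLeastLessThan_iff int_eq_iff nat_less_iff)
      with coeff_p[of i] \<open>p = 0\<close> show ?thesis
        by (simp add: S_def lookup_sum lookup_single when_def)
    next
      case False
      then have "Poly_Mapping.lookup S e = 0"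
        unfolding S_def lookup_sum by (intro sum.neutral) (auto simp: lookup_single when_def)
      then show ?thesis using False R0 by simp
    qed
  qed
  then have "qint (int n) dvd R" using S by simp
  with \<open>qint (int n) dvd c - R\<close> have "qint (int n) dvd (c - R) + R" by (rule dvd_add)
  then show ?thesis by simp
qed

section \<open>Evaluation of polynomials in \<open>x\<close>\<close>

lemma map_poly_ev_add: "map_poly (ev z) (p + q) = map_poly (ev z) p + map_poly (ev z) q"
  by (rule poly_eqI) (simp add: coeff_map_poly)

lemma map_poly_ev_sum: "map_poly (ev z) (sum f A) = (\<Sum>i\<in>A. map_poly (ev z) (f i))"
  by (induction A rule: infinite_finite_induct) (simp_all add: map_poly_ev_add)

lemma map_poly_ev_mult:
  "z \<noteq> 0 \<Longrightarrow> map_poly (ev z) (p * q) = map_poly (ev z) p * map_poly (ev z) q"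
  by (rule poly_eqI) (simp add: coeff_map_poly coeff_mult)

lemma map_poly_ev_power: "z \<noteq> 0 \<Longrightarrow> map_poly (ev z) (p ^ k) = map_poly (ev z) p ^ k"
  by (induction k) (simp_all add: map_poly_1' map_poly_ev_mult)

lemma map_poly_ev_prod:
  "z \<noteq> 0 \<Longrightarrow> map_poly (ev z) (prod f A) = (\<Prod>i\<in>A. map_poly (ev z) (f i))"
  by (induction A rule: infinite_finite_induct) (simp_all add: map_poly_1' map_poly_ev_mult)

text \<open>Divisibility by a constant polynomial is divisibility of every coefficient, so the
  criterion for Laurent polynomials applies to each of them.\<close>

lemma const_qint_dvd_if_vanishing:
  assumes "n > 0"
    and "\<And>z::complex. z ^ n = 1 \<Longrightarrow> z \<noteq> 1 \<Longrightarrow> map_poly (ev z) p = 0"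
  shows "[:qint (int n):] dvd p"
  unfolding const_poly_dvd_iff
proof
  fix i
  show "qint (int n) dvd coeff p i"
  proof (rule qint_dvd_if_vanishing[OF assms(1)])
    fix z :: complex assume "z ^ n = 1" "z \<noteq> 1"
    then have "coeff (map_poly (ev z) p) i = 0" using assms(2) by simp
    then show "ev z (coeff p i) = 0" by (simp add: coeff_map_poly)
  qed
qed

section \<open>Identities for \<open>q\<close>-binomial coefficients\<close>

text \<open>Multiplied by \<open>[1] ... [k]\<close>, both sides become the numerator with
  \<open>k + 1\<close> factors; this nonzero product can be cancelled in an integral domain.\<close>

lemma qbinom_Suc_mult:
  "qint (int k + 1) * qbinom N (int k + 1) = qint (int N - int k) * qbinom N (int k)"
proof -
  let ?F = "\<Prod>j\<in>{1..int k}. qint j"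
  have "?F \<noteq> 0" by auto
  have "qint (int k + 1) * qbinom N (int k + 1) * ?F
      = (\<Prod>j\<in>{1..int (Suc k)}. qint (int N - j + 1))"
    using qbinom_mult[of "int (Suc k)" N]
    by (simp only: atLeastAtMost_1_int_Suc) (simp add: mult_ac add.commute)
  also have "\<dots> = qint (int N - int k) * (qbinom N (int k) * ?F)"
    by (simp only: atLeastAtMost_1_int_Suc qbinom_mult) (simp add: qbinom_mult)
  finally show ?thesis using \<open>?F \<noteq> 0\<close> by (simp add: mult.assoc[symmetric])
qed

lemma qbinom_absorption:
  "qint (int k + 1) * qbinom (Suc N) (int k + 1) = qint (int N + 1) * qbinom N (int k)"
proof -
  let ?F = "\<Prod>j\<in>{1..int k}. qint j"
  have "?F \<noteq> 0" by auto
  have "qint (int k + 1) * qbinom (Suc N) (int k + 1) * ?F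
      = (\<Prod>j\<in>{1..int (Suc k)}. qint (int (Suc N) - j + 1))"
    using qbinom_mult[of "int (Suc k)" "Suc N"]
    by (simp only: atLeastAtMost_1_int_Suc) (simp add: mult_ac add.commute)
  also have "\<dots> = qint (int N + 1) * (qbinom N (int k) * ?F)"
    unfolding qbinom_numerator_Suc by (simp add: qbinom_mult)
  finally show ?thesis using \<open>?F \<noteq> 0\<close> by (simp add: mult.assoc[symmetric])
qed

text \<open>Absorption turns the claim, multiplied by \<open>[k + 1]\<close>, into the splitting
  \<open>[N + 1] = [k + 1] + q^(k+1) [N - k]\<close>.\<close>

lemma qbinom_Pascal:
  "qbinom (Suc N) (int k + 1) = qbinom N (int k) + qpow (int k + 1) * qbinom N (int k + 1)"
proof -
  have "qint (int k + 1) * qbinom (Suc N) (int k + 1)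
      = (qint (int k + 1) + qpow (int k + 1) * qint (int N - int k)) * qbinom N (int k)"
    unfolding qbinom_absorption using qint_add[of "int k + 1" "int N - int k"]
    by (simp add: add.commute)
  also have "\<dots> = qint (int k + 1) * (qbinom N (int k) + qpow (int k + 1) * qbinom N (int k + 1))"
    using qbinom_Suc_mult[of k N] by (simp add: algebra_simps)
  finally show ?thesis by simp
qed

lemma qint_1 [simp]: "qint 1 = 1"
  by (rule qint_eqI) simp

lemma qbinom_self: "qbinom N (int N) = 1"
proof (induction N)
  case (Suc N)
  then show ?case using qbinom_Pascal[of N N] by (simp add: qbinom_eq_0 add.commute)
qed simp

section \<open>A product formula for the coefficients of \<open>w\<close>\<close>

definition qbinom_pair :: "nat \<Rightarrow> nat \<Rightarrow> laurent" where
  "qbinom_pair k t = qbinom (k - 1) (int t) * qbinom (k + t + 1) (int t)"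

text \<open>The base of the \<open>\<alpha>\<close>-th power in the coefficient of
  \<open>x^i\<close> in \<open>w \<alpha> k\<close>; \<open>i\<close> stands for
  \<open>j - 1\<close>.\<close>

definition w_diff :: "nat \<Rightarrow> nat \<Rightarrow> laurent" where
  "w_diff k i = qbinom (k - 1) (int i) * qbinom (k + i + 1) (int i + 1)
         - qbinom k (int i + 1) * qbinom (k + i + 1) (int i)"

text \<open>Multiplication by \<open>[i + 1]\<close> turns the two products into
  \<open>[k + 1]\<close> and \<open>[k]\<close> times the same \<open>qbinom_pair\<close>, and
  \<open>[k + 1] - [k] = q^k\<close>.\<close>

lemma qint_mult_w_diff:
  assumes "k > 0"
  shows "qint (int i + 1) * w_diff k i = qpow (int k) * qbinom_pair k i"
proof -
  have 1: "qint (int i + 1) * qbinom (k + i + 1) (int i + 1)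
      = qint (int k + 1) * qbinom (k + i + 1) (int i)"
    using qbinom_Suc_mult[of i "k + i + 1"] by (simp add: add.commute)
  have 2: "qint (int i + 1) * qbinom k (int i + 1) = qint (int k) * qbinom (k - 1) (int i)"
    using qbinom_absorption[of i "k - 1"] assms by simp
  have "qint (int i + 1) * w_diff k i
      = qbinom (k - 1) (int i) * (qint (int i + 1) * qbinom (k + i + 1) (int i + 1))
        - (qint (int i + 1) * qbinom k (int i + 1)) * qbinom (k + i + 1) (int i)"
    unfolding w_diff_def by (simp only: right_diff_distrib mult_ac)
  also have "\<dots> = (qint (int k + 1) - qint (int k)) * qbinom_pair k i"
    unfolding 1 2 qbinom_pair_def by (simp add: algebra_simps)
  also have "qint (int k + 1) - qint (int k) = qpow (int k)"
    using qint_add[of "int k" 1] by simp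
  finally show ?thesis .
qed

text \<open>Prepares the reflection \<open>k \<mapsto> -1 - k\<close>, which exchanges
  \<open>k - 1 - t\<close> and \<open>k + t + 2\<close> up to sign.\<close>

lemma qbinom_pair_Suc:
  assumes "k > 0"
  shows "qint (int t + 1) ^ 2 * qbinom_pair k (Suc t)
      = qint (int k - 1 - int t) * qint (int k + int t + 2) * qbinom_pair k t"
proof -
  have 1: "qint (int t + 1) * qbinom (k - 1) (int t + 1)
      = qint (int k - 1 - int t) * qbinom (k - 1) (int t)"
    using qbinom_Suc_mult[of t "k - 1"] assms by (simp add: of_nat_diff)
  have 2: "qint (int t + 1) * qbinom (k + t + 2) (int t + 1)
      = qint (int k + int t + 2) * qbinom (k + t + 1) (int t)"
    using qbinom_absorption[of t "k + t + 1"] by (simp add: ac_simps)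
  have "qint (int t + 1) ^ 2 * qbinom_pair k (Suc t)
      = (qint (int t + 1) * qbinom (k - 1) (int t + 1))
        * (qint (int t + 1) * qbinom (k + t + 2) (int t + 1))"
    by (simp add: qbinom_pair_def power2_eq_square ac_simps)
  then show ?thesis unfolding 1 2 qbinom_pair_def by (simp only: mult_ac)
qed

text \<open>Valid for every \<open>i\<close>: if \<open>i \<ge> k\<close>, then
  \<open>w_diff k i\<close> is 0, and so is its power because \<open>\<alpha> > 0\<close>.\<close>

lemma coeff_w:
  assumes "\<alpha> > 0" "k > 0"
  shows "coeff (w \<alpha> k) i
      = qpow (int \<alpha> * (int (Suc (Suc i) choose 2) - (int k + 1) * int i)) * w_diff k i ^ \<alpha>"
proof (cases "i < k")
  case True
  have "coeff (w \<alpha> k) i = (\<Sum>j=1..k. if j = Suc i then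
      qpow (int \<alpha> * (int (Suc (Suc i) choose 2) - (int k + 1) * int i)) * w_diff k i ^ \<alpha> else 0)"
    unfolding w_def coeff_sum by (intro sum.cong refl) (auto simp: w_diff_def ac_simps)
  then show ?thesis using True by simp
next
  case False
  then have "w_diff k i = 0" using assms(2) by (simp add: w_diff_def qbinom_eq_0)
  moreover have "coeff (w \<alpha> k) i = 0"
    unfolding w_def coeff_sum using False by (intro sum.neutral) auto
  ultimately show ?thesis using assms(1) by (simp add: power_0_left)
qed

lemma div_mod_eqI:
  fixes N a s d :: nat
  assumes "N = a * d + s" "s < d"
  shows "N div d = a" "N mod d = s"
  using assms by auto

section \<open>Reflection at a root of unity\<close>

text \<open>\<open>\<zeta>\<close> has exact order \<open>d\<close>. Integer exponents suit Laurent
  polynomials; with \<open>d > 1\<close> the equivalence makes \<open>\<zeta>\<close> different from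
  0 and 1.\<close>

locale root_of_unity =
  fixes \<zeta> :: complex and d :: nat
  assumes d_gt_1: "d > 1" and powi_eq_1_iff: "\<zeta> powi e = 1 \<longleftrightarrow> int d dvd e"
begin

lemma nonzero [simp]: "\<zeta> \<noteq> 0"
  using powi_eq_1_iff[of "int d"] d_gt_1 by (auto simp: power_0_left)

lemma neq_1: "\<zeta> \<noteq> 1"
  using powi_eq_1_iff[of 1] d_gt_1 by (auto simp: zdvd1_eq)

lemma powi_cong: "int d dvd x - y \<Longrightarrow> \<zeta> powi x = \<zeta> powi y"
  using powi_eq_1_iff[of "x - y"] by (simp add: power_int_diff)

lemma ev_qint: "ev \<zeta> (qint N) = (1 - \<zeta> powi N) / (1 - \<zeta>)"
proof -
  have "ev \<zeta> (qint N) * (1 - \<zeta>) = 1 - \<zeta> powi N"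
    using arg_cong[OF qint_mult[of N], of "ev \<zeta>"] by simp
  then show ?thesis using neq_1 by (simp add: field_simps)
qed

lemma ev_qint_eq_0_iff: "ev \<zeta> (qint N) = 0 \<longleftrightarrow> int d dvd N"
  using neq_1 powi_eq_1_iff[of N] by (auto simp: ev_qint)

lemma ev_qint_cong: "int d dvd x - y \<Longrightarrow> ev \<zeta> (qint x) = ev \<zeta> (qint y)"
  using powi_cong[of x y] by (simp add: ev_qint)

lemma ev_qint_minus: "ev \<zeta> (qint (- N)) = - (\<zeta> powi - N) * ev \<zeta> (qint N)"
proof -
  have "1 - inverse (\<zeta> powi N) = - inverse (\<zeta> powi N) * (1 - \<zeta> powi N)"
    by (simp add: right_diff_distrib)
  then show ?thesis by (simp only: ev_qint power_int_minus times_divide_eq_right)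
qed

section \<open>The \<open>q\<close>-Lucas theorem\<close>

lemma ev_qbinom_d_eq_0:
  assumes "Suc e < d"
  shows "ev \<zeta> (qbinom d (int e + 1)) = 0"
proof -
  \<comment> \<open>Absorption leaves \<open>[d]\<close>, which vanishes at \<open>\<zeta>\<close>,
    on the right and the nonzero \<open>[e + 1]\<close> on the left.\<close>
  have "ev \<zeta> (qint (int e + 1)) * ev \<zeta> (qbinom d (int e + 1))
      = ev \<zeta> (qint (int d)) * ev \<zeta> (qbinom (d - 1) (int e))"
    using arg_cong[OF qbinom_absorption[of e "d - 1"], of "ev \<zeta>"] d_gt_1 by simp
  moreover have "ev \<zeta> (qint (int d)) = 0" by (simp add: ev_qint_eq_0_iff)
  moreover have "ev \<zeta> (qint (int e + 1)) \<noteq> 0"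
    unfolding ev_qint_eq_0_iff using assms zdvd_imp_le[of "int d" "int e + 1"] by auto
  ultimately show ?thesis by simp
qed

text \<open>Induction on \<open>N\<close> by the Pascal rule with \<open>k = l + 1\<close>. The
  cases record whether the residues of \<open>l\<close> and \<open>N\<close> modulo \<open>d\<close>
  are \<open>d - 1\<close>, that is, whether the quotients grow in the step.\<close>

lemma q_Lucas:
  "ev \<zeta> (qbinom N (int k))
    = of_nat ((N div d) choose (k div d)) * ev \<zeta> (qbinom (N mod d) (int (k mod d)))"
proof (induction N arbitrary: k)
  case 0
  show ?case
  proof (cases "k < d")
    case False
    then have "k div d > 0" using d_gt_1 by (simp add: div_greater_zero_iff)
    then show ?thesis using False d_gt_1 by (simp add: qbinom_eq_0 binomial_eq_0)
  qed simp
next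
  case (Suc N)
  show ?case
  proof (cases k)
    case 0
    then show ?thesis by simp
  next
    case (Suc l)
    define a b c e where abce: "a = N div d" "b = N mod d" "c = l div d" "e = l mod d"
    have lt: "b < d" "e < d" using d_gt_1 by (simp_all add: abce)
    have Pascal: "ev \<zeta> (qbinom (Suc M) (int j + 1))
        = ev \<zeta> (qbinom M (int j)) + \<zeta> powi (int j + 1) * ev \<zeta> (qbinom M (int j + 1))" for M j
      by (simp add: qbinom_Pascal)
    have LHS: "ev \<zeta> (qbinom (Suc N) (int k))
        = of_nat (a choose c) * ev \<zeta> (qbinom b (int e))
          + \<zeta> powi (int l + 1)
            * (of_nat (a choose (k div d)) * ev \<zeta> (qbinom b (int (k mod d))))"
      using Pascal[of N l] Suc.IH[of l] Suc.IH[of k] by (simp add: Suc abce add.commute)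
    show ?thesis
    proof (cases "Suc e = d")
      case True
      then have k: "k div d = Suc c" "k mod d = 0" by (auto simp: Suc abce div_Suc mod_Suc)
      have "l + 1 = d * Suc c"
        using True mult_div_mod_eq[of d l] unfolding abce mult_Suc_right by linarith
      then have "int l + 1 = int d * int (Suc c)" by (metis of_nat_1 of_nat_add of_nat_mult)
      then have z: "\<zeta> powi (int l + 1) = 1" using powi_eq_1_iff by simp
      show ?thesis
      proof (cases "Suc b = d")
        case b: True
        then have "Suc N div d = Suc a" "Suc N mod d = 0" by (auto simp: abce div_Suc mod_Suc)
        moreover have "e = b" using True b by simp
        \<comment> \<open>Both residues wrap around: what remains is the Pascal rule for the
          ordinary binomial coefficients of the quotients.\<close>
        ultimately show ?thesis unfolding LHS k z by (simp add: qbinom_self)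
      next
        case b: False
        then have "Suc N div d = a" "Suc N mod d = Suc b" by (auto simp: abce div_Suc mod_Suc)
        moreover have "b < e" using True b lt by simp
        ultimately show ?thesis unfolding LHS k z by (simp add: qbinom_eq_0)
      qed
    next
      case False
      then have k: "k div d = c" "k mod d = Suc e" by (auto simp: Suc abce div_Suc mod_Suc)
      have "int l - int e = int d * int c"
        using mult_div_mod_eq[of d l] by (simp add: abce algebra_simps flip: of_nat_mult of_nat_add)
      then have z: "\<zeta> powi (int l + 1) = \<zeta> powi (int e + 1)" by (intro powi_cong) simp
      have LHS': "ev \<zeta> (qbinom (Suc N) (int k))
          = of_nat (a choose c) * ev \<zeta> (qbinom (Suc b) (int e + 1))"
        unfolding LHS k z Pascal by (simp add: algebra_simps)
      show ?thesis
      proof (cases "Suc b = d")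
        case b: True
        then have "Suc N div d = Suc a" "Suc N mod d = 0" by (auto simp: abce div_Suc mod_Suc)
        moreover have "Suc e < d" using False lt by simp
        \<comment> \<open>Only the residue of \<open>N\<close> wraps around: the left side contains
          the interior coefficient \<open>qbinom d (e + 1)\<close>, the right side
          \<open>qbinom 0 (e + 1)\<close>, and both vanish at \<open>\<zeta>\<close>.\<close>
        ultimately show ?thesis
          unfolding LHS' k b using ev_qbinom_d_eq_0[of e] by (simp add: qbinom_eq_0)
      next
        case b: False
        then have "Suc N div d = a" "Suc N mod d = Suc b" by (auto simp: abce div_Suc mod_Suc)
        then show ?thesis unfolding LHS' k by (simp add: add.commute)
      qed
    qed
  qed
qed

section \<open>Reflection of the coefficients of \<open>w\<close>\<close>

lemma ev_qbinom_eq_0: "N mod d < k mod d \<Longrightarrow> ev \<zeta> (qbinom N (int k)) = 0"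
  by (subst q_Lucas) (simp add: qbinom_eq_0)

text \<open>Induction on \<open>t\<close> by the recurrence of \<open>qbinom_pair\<close>. As
  \<open>k'\<close> is congruent to \<open>-1 - k\<close>, its two numerator factors are exchanged;
  the signs cancel and each step contributes \<open>\<zeta>^-(2k+1)\<close>. The bound
  \<open>t < d\<close> keeps the divisors nonzero.\<close>

lemma ev_qbinom_pair_reflect:
  assumes "k > 0" "k' > 0" "d dvd k + k' + 1" "t < d"
  shows "ev \<zeta> (qbinom_pair k' t) = \<zeta> powi (- (2 * int k + 1) * int t) * ev \<zeta> (qbinom_pair k t)"
  using assms(4)
proof (induction t)
  case 0
  then show ?case by (simp add: qbinom_pair_def)
next
  case (Suc t)
  let ?Q = "\<lambda>N. ev \<zeta> (qint N)"
  let ?z = "\<zeta> powi (- (2 * int k + 1))"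
  have dvd: "int d dvd int k + int k' + 1"
    using assms(3) by (metis int_dvd_int_iff of_nat_1 of_nat_add)
  have nz: "?Q (int t + 1) \<noteq> 0"
    unfolding ev_qint_eq_0_iff using Suc.prems zdvd_imp_le[of "int d" "int t + 1"] by auto
  have step: "?Q (int t + 1) ^ 2 * ev \<zeta> (qbinom_pair l (Suc t))
      = ?Q (int l - 1 - int t) * ?Q (int l + int t + 2) * ev \<zeta> (qbinom_pair l t)" if "l > 0" for l
    using arg_cong[OF qbinom_pair_Suc[OF that, of t], of "ev \<zeta>"] by simp
  have q1: "?Q (int k' - 1 - int t) = - (\<zeta> powi - (int k + int t + 2)) * ?Q (int k + int t + 2)"
    unfolding ev_qint_minus[symmetric] using dvd by (intro ev_qint_cong) (simp add: algebra_simps)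
  have q2: "?Q (int k' + int t + 2) = - (\<zeta> powi - (int k - 1 - int t)) * ?Q (int k - 1 - int t)"
    unfolding ev_qint_minus[symmetric] using dvd by (intro ev_qint_cong) (simp add: algebra_simps)
  have z: "\<zeta> powi - (int k + int t + 2) * \<zeta> powi - (int k - 1 - int t) = ?z"
    by (simp flip: power_int_add)
  have "?Q (int t + 1) ^ 2 * ev \<zeta> (qbinom_pair k' (Suc t))
      = (\<zeta> powi - (int k + int t + 2) * \<zeta> powi - (int k - 1 - int t))
        * (?Q (int k - 1 - int t) * ?Q (int k + int t + 2) * ev \<zeta> (qbinom_pair k' t))"
    unfolding step[OF assms(2)] q1 q2 by simp
  also have "\<dots> = ?z * \<zeta> powi (- (2 * int k + 1) * int t)
        * (?Q (int k - 1 - int t) * ?Q (int k + int t + 2) * ev \<zeta> (qbinom_pair k t))"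
    unfolding z using Suc by simp
  also have "?z * \<zeta> powi (- (2 * int k + 1) * int t) = \<zeta> powi (- (2 * int k + 1) * int (Suc t))"
    by (simp add: algebra_simps flip: power_int_add)
  finally show ?case
    unfolding step[OF assms(1), symmetric] using nz by simp
qed

text \<open>The residue of \<open>k\<close> is positive, so \<open>k - 1\<close> has the same
  quotient as \<open>k\<close>, and the \<open>q\<close>-Lucas theorem applies to both factors of
  the pair.\<close>

lemma ev_qbinom_pair_Lucas:
  assumes "k mod d > 0" "k mod d + 1 < d" "t mod d + 1 < d"
  shows "ev \<zeta> (qbinom_pair k t) = of_nat ((k div d choose t div d) * (k div d + t div d choose t div d))
    * ev \<zeta> (qbinom_pair (k mod d) (t mod d))"
proof -
  define a b c e where abce: "a = k div d" "b = k mod d" "c = t div d" "e = t mod d"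
  have k: "k = a * d + b" and t: "t = c * d + e" by (simp_all add: abce)
  have b: "b > 0" "b + 1 < d" and e: "e + 1 < d" using assms by (simp_all add: abce)
  obtain b1 where b1: "b = Suc b1" using b by (cases b) auto
  then have "k - 1 = a * d + b1" by (simp add: k)
  then have k1: "(k - 1) div d = a" "(k - 1) mod d = b - 1"
    using b b1 div_mod_eqI[of "k - 1" a d b1] by simp_all
  have B1: "ev \<zeta> (qbinom (k - 1) (int t)) = of_nat (a choose c) * ev \<zeta> (qbinom (b - 1) (int e))"
    unfolding q_Lucas[of "k - 1" t] k1 by (simp only: abce)
  show ?thesis
  proof (cases "b + e + 1 < d")
    case True
    have "k + t + 1 = (a + c) * d + (b + e + 1)" by (simp add: k t algebra_simps)
    then have "(k + t + 1) div d = a + c" "(k + t + 1) mod d = b + e + 1"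
      using True by (rule div_mod_eqI)+
    then have "ev \<zeta> (qbinom (k + t + 1) (int t))
        = of_nat (a + c choose c) * ev \<zeta> (qbinom (b + e + 1) (int e))"
      using q_Lucas[of "k + t + 1" t] by (simp flip: abce)
    then show ?thesis using B1 unfolding qbinom_pair_def by (simp flip: abce)
  next
    case False
    \<comment> \<open>After a carry the residue \<open>b + e + 1 - d\<close> is below
      \<open>e\<close>, because \<open>b + 1 < d\<close>; so the second factor of the pair vanishes
      on both sides.\<close>
    have "k + t + 1 = (a + c + 1) * d + (b + e + 1 - d)"
      using False by (simp add: k t algebra_simps)
    then have "(k + t + 1) mod d = b + e + 1 - d"
      by (rule div_mod_eqI(2)) (use b e in simp)
    moreover have "(b + e + 1) mod d = b + e + 1 - d" using False b e by (simp add: mod_if)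
    ultimately show ?thesis
      unfolding qbinom_pair_def abce(2,4)[symmetric] using b e False
      by (simp add: ev_qbinom_eq_0 flip: abce)
  qed
qed

text \<open>Each product in \<open>w_diff\<close> has a factor whose lower index has residue
  \<open>d - 1\<close> and whose upper index has a smaller residue.\<close>

lemma ev_w_diff_eq_0:
  assumes "k mod d > 0" "k mod d + 1 < d" "i mod d + 1 = d"
  shows "ev \<zeta> (w_diff k i) = 0"
proof -
  have "(k - 1) mod d = k mod d - 1"
  proof -
    have "k - 1 = k div d * d + (k mod d - 1)" using assms(1) by (simp add: div_mult_mod_eq flip: diff_add_assoc)
    moreover have "k mod d - 1 < d" using assms(2) by simp
    ultimately show ?thesis by (metis mod_less mod_mult_self3)
  qed
  then have "ev \<zeta> (qbinom (k - 1) (int i)) = 0" using assms by (intro ev_qbinom_eq_0) simp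
  moreover have "(k + i + 1) mod d = k mod d"
  proof -
    have "(i + 1) mod d = 0" using assms(3) by (simp add: mod_Suc)
    then show ?thesis by (metis add.assoc add_0_right mod_add_right_eq)
  qed
  then have "ev \<zeta> (qbinom (k + i + 1) (int i)) = 0" using assms by (intro ev_qbinom_eq_0) simp
  ultimately show ?thesis by (simp add: w_diff_def)
qed

text \<open>
  If \<open>d\<close> does not divide \<open>i + 1\<close>, then \<open>[i + 1]\<close> can be cancelled from the product formula;
  otherwise both sides vanish by the \<open>q\<close>-Lucas theorem.
\<close>

lemma ev_w_diff_reflect:
  assumes "k div d = k' div d" "k mod d + k' mod d + 1 = d" "k mod d > 0" "k' mod d > 0"
  shows "ev \<zeta> (w_diff k' i) = \<zeta> powi (- (2 * int k + 1) * (int i + 1)) * ev \<zeta> (w_diff k i)"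
proof (cases "i mod d + 1 = d")
  case True
  then show ?thesis using assms by (simp add: ev_w_diff_eq_0)
next
  case False
  define a b b' c e where abce: "a = k div d" "b = k mod d" "b' = k' mod d" "c = i div d" "e = i mod d"
  have e: "e + 1 < d"
    using False mod_less_divisor[of d i] d_gt_1 unfolding abce by linarith
  have b: "b > 0" "b + 1 < d" "b' > 0" "b' + 1 < d" "b' + 1 + b = d" using assms by (simp_all add: abce)
  have k: "int k = int a * int d + int b"
    unfolding abce by (metis div_mult_mod_eq of_nat_add of_nat_mult)
  have k': "int k' = int a * int d + int b'"
    unfolding abce assms(1) by (metis div_mult_mod_eq of_nat_add of_nat_mult)
  have i: "int i = int c * int d + int e"
    unfolding abce by (metis div_mult_mod_eq of_nat_add of_nat_mult)
  have d: "int d = int b' + 1 + int b" using b(5) by linarith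
  have pos: "k > 0" "k' > 0" using assms(3,4) by (auto intro!: Nat.gr0I)
  have nz: "ev \<zeta> (qint (int i + 1)) \<noteq> 0"
  proof
    assume "ev \<zeta> (qint (int i + 1)) = 0"
    then have "int d dvd int (Suc i)" unfolding ev_qint_eq_0_iff by (simp add: add.commute)
    then have "d dvd Suc i" by (simp only: int_dvd_int_iff)
    then have "Suc i mod d = 0" by simp
    with False show False by (simp add: mod_Suc split: if_splits)
  qed
  have prod: "ev \<zeta> (qint (int i + 1)) * ev \<zeta> (w_diff l i)
      = \<zeta> powi int l * ev \<zeta> (qbinom_pair l i)" if "l > 0" for l
    using arg_cong[OF qint_mult_w_diff[OF that, of i], of "ev \<zeta>"] by simp
  \<comment> \<open>The reflection of \<open>qbinom_pair\<close> needs a lower index below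
    \<open>d\<close>, so it is applied to the residues; the factor coming from the quotients is
    common to \<open>k\<close> and \<open>k'\<close>.\<close>
  have "ev \<zeta> (qbinom_pair k' i) = of_nat ((a choose c) * (a + c choose c)) * ev \<zeta> (qbinom_pair b' e)"
    using ev_qbinom_pair_Lucas[of k' i] b e assms(1) by (simp flip: abce)
  also have "ev \<zeta> (qbinom_pair b' e) = \<zeta> powi (- (2 * int b + 1) * int e) * ev \<zeta> (qbinom_pair b e)"
    using b e by (intro ev_qbinom_pair_reflect) (auto simp: add_ac)
  also have "of_nat ((a choose c) * (a + c choose c)) * \<dots>
      = \<zeta> powi (- (2 * int b + 1) * int e) * ev \<zeta> (qbinom_pair k i)"
    using ev_qbinom_pair_Lucas[of k i] b e by (simp flip: abce)
  finally have "ev \<zeta> (qint (int i + 1)) * ev \<zeta> (w_diff k' i)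
      = \<zeta> powi int k' * \<zeta> powi (- (2 * int b + 1) * int e) * ev \<zeta> (qbinom_pair k i)"
    unfolding prod[OF pos(2)] by simp
  also have "\<zeta> powi int k' * \<zeta> powi (- (2 * int b + 1) * int e)
      = \<zeta> powi (- (2 * int k + 1) * (int i + 1)) * \<zeta> powi int k"
  proof -
    have "int k' + - (2 * int b + 1) * int e - (- (2 * int k + 1) * (int i + 1) + int k)
        = int d * (1 + 2 * int a * (int i + 1) + (2 * int b + 1) * int c)"
      unfolding k k' i d by (simp add: algebra_simps)
    then show ?thesis by (simp only: power_int_add[symmetric] nonzero simp_thms, intro powi_cong) simp
  qed
  also have "\<dots> * ev \<zeta> (qbinom_pair k i)
      = \<zeta> powi (- (2 * int k + 1) * (int i + 1)) * (\<zeta> powi int k * ev \<zeta> (qbinom_pair k i))"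
    by (rule mult.assoc)
  finally show ?thesis
    unfolding prod[OF pos(1), symmetric] using nz by (simp add: mult.left_commute)
qed

text \<open>The power of \<open>q\<close> in front of \<open>w_diff\<close> makes the dependence of
  the exponent on \<open>i\<close> a multiple of \<open>k + k' + 1\<close>, hence of
  \<open>d\<close>; one scalar therefore serves all coefficients.\<close>

lemma ev_w_reflect:
  assumes "\<alpha> > 0"
    and "k div d = k' div d" "k mod d + k' mod d + 1 = d" "k mod d > 0" "k' mod d > 0"
  shows "map_poly (ev \<zeta>) (w \<alpha> k')
    = smult (\<zeta> powi (- int \<alpha> * (2 * int k + 1))) (map_poly (ev \<zeta>) (w \<alpha> k))"
proof (rule poly_eqI)
  fix i
  have pos: "k > 0" "k' > 0" using assms(4,5) by (auto intro!: Nat.gr0I)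
  have "k + k' + 1 = d * (2 * (k div d) + 1)"
  proof -
    have "k = k div d * d + k mod d" "k' = k div d * d + k' mod d"
      by (simp only: div_mult_mod_eq) (simp only: assms(2) div_mult_mod_eq)
    moreover have "d * (2 * (k div d) + 1) = 2 * (k div d * d) + d" by (simp add: algebra_simps)
    ultimately show ?thesis using assms(3) by linarith
  qed
  then have kk: "int k + int k' + 1 = int d * int (2 * (k div d) + 1)"
    by (metis of_nat_1 of_nat_add of_nat_mult)
  let ?T = "int (Suc (Suc i) choose 2)"
  have "\<zeta> powi (int \<alpha> * (?T - (int k' + 1) * int i)) * (\<zeta> powi (- (2 * int k + 1) * (int i + 1))) ^ \<alpha>
      = \<zeta> powi (- int \<alpha> * (2 * int k + 1)) * \<zeta> powi (int \<alpha> * (?T - (int k + 1) * int i))"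
    unfolding power_int_power'
  proof -
    have "int \<alpha> * (?T - (int k' + 1) * int i) + - (2 * int k + 1) * (int i + 1) * int \<alpha>
        - (- int \<alpha> * (2 * int k + 1) + int \<alpha> * (?T - (int k + 1) * int i))
        = (int k + int k' + 1) * - (int \<alpha> * int i)"
      by (simp add: algebra_simps)
    then show "\<zeta> powi (int \<alpha> * (?T - (int k' + 1) * int i))
        * \<zeta> powi (- (2 * int k + 1) * (int i + 1) * int \<alpha>)
      = \<zeta> powi (- int \<alpha> * (2 * int k + 1)) * \<zeta> powi (int \<alpha> * (?T - (int k + 1) * int i))"
      unfolding kk by (simp only: power_int_add[symmetric] nonzero simp_thms, intro powi_cong) simp
  qed
  then show "coeff (map_poly (ev \<zeta>) (w \<alpha> k')) i
      = coeff (smult (\<zeta> powi (- int \<alpha> * (2 * int k + 1))) (map_poly (ev \<zeta>) (w \<alpha> k))) i"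
    by (simp add: coeff_map_poly coeff_w assms(1) pos ev_w_diff_reflect[OF assms(2-5)] power_mult_distrib
        mult.assoc[symmetric])
qed

end

section \<open>Cancellation in the sum\<close>

lemma pochhammer_reflect_cong:
  assumes "d dvd k + k' + 2 * \<beta>"
  shows "[int (pochhammer k' \<beta>) = (- 1) ^ \<beta> * int (pochhammer (k + \<beta> + 1) \<beta>)] (mod int d)"
proof -
  have "int d dvd int k' - (- (int k + 2 * int \<beta>))"
    using assms by (metis (no_types, opaque_lifting) add.commute add.left_commute diff_minus_eq_add
        int_dvd_int_iff of_nat_add of_nat_mult of_nat_numeral)
  then have "[int k' = - (int k + 2 * int \<beta>)] (mod int d)"
    by (simp add: cong_iff_dvd_diff)
  then have "[pochhammer (int k') \<beta> = pochhammer (- (int k + 2 * int \<beta>)) \<beta>] (mod int d)"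
    unfolding pochhammer_prod by (intro cong_prod cong_add) auto
  \<comment> \<open>\<open>pochhammer (-x) \<beta>\<close> is \<open>(-1)^\<beta>\<close> times the
    rising product that ends at \<open>x\<close>; for \<open>x = k + 2\<beta>\<close> it starts at
    \<open>k + \<beta> + 1\<close>.\<close>
  also have "pochhammer (- (int k + 2 * int \<beta>)) \<beta>
      = (- 1) ^ \<beta> * pochhammer (int (k + \<beta> + 1)) \<beta>"
    unfolding pochhammer_minus by (simp add: algebra_simps)
  finally show ?thesis by (simp only: pochhammer_of_nat)
qed

text \<open>The single reflection is used once from \<open>k\<close> to \<open>k'\<close> and once
  backwards, so the two Pochhammer symbols trade places and the signs cancel.\<close>

lemma pochhammer_product_reflect_cong:
  assumes "d dvd k + k' + 2 * \<beta>"
  shows "[int (pochhammer k' \<beta> * pochhammer (k' + \<beta> + 1) \<beta>)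
    = int (pochhammer k \<beta> * pochhammer (k + \<beta> + 1) \<beta>)] (mod int d)"
proof -
  let ?s = "(- 1) ^ \<beta> :: int"
  have "?s * ?s = 1" by (simp flip: power_mult_distrib)
  have "[int (pochhammer k' \<beta>) * (?s * int (pochhammer (k' + \<beta> + 1) \<beta>))
      = (?s * int (pochhammer (k + \<beta> + 1) \<beta>)) * int (pochhammer k \<beta>)] (mod int d)"
    using assms by (intro cong_mult pochhammer_reflect_cong cong_sym[OF pochhammer_reflect_cong])
      (auto simp: add_ac)
  then have "[?s * (int (pochhammer k' \<beta>) * (?s * int (pochhammer (k' + \<beta> + 1) \<beta>)))
      = ?s * ((?s * int (pochhammer (k + \<beta> + 1) \<beta>)) * int (pochhammer k \<beta>))] (mod int d)"
    by (rule cong_scalar_left)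
  also have "?s * (int (pochhammer k' \<beta>) * (?s * int (pochhammer (k' + \<beta> + 1) \<beta>)))
      = int (pochhammer k' \<beta> * pochhammer (k' + \<beta> + 1) \<beta>)"
    using \<open>?s * ?s = 1\<close> by (simp add: mult.left_commute[of _ ?s] mult.assoc[symmetric])
  also have "?s * ((?s * int (pochhammer (k + \<beta> + 1) \<beta>)) * int (pochhammer k \<beta>))
      = int (pochhammer k \<beta> * pochhammer (k + \<beta> + 1) \<beta>)"
    using \<open>?s * ?s = 1\<close> by (simp add: mult.assoc[symmetric])
  finally show ?thesis .
qed

lemma dvd_pochhammer_nat:
  fixes a d i n :: nat
  assumes "d dvd a + i" "i < n"
  shows "d dvd pochhammer a n"
  unfolding pochhammer_prod
  by (rule dvd_trans[OF _ dvd_prodI[of _ i]]) (use assms in auto)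

definition summand_const :: "nat \<Rightarrow> nat \<Rightarrow> nat \<Rightarrow> nat \<Rightarrow> nat \<Rightarrow> nat \<Rightarrow> laurent" where
  "summand_const \<alpha> \<beta> m n r k =
     qint (int (pochhammer k \<beta> * pochhammer (k + \<beta> + 1) \<beta>)) ^ r
     * qint (int (2 * (k + \<beta>)))
     * qpow ((int n - 2 * int \<beta> - int k) * int (2 * \<beta> * \<alpha> * m + 1))"

text \<open>The sum equals its own negative; at a fixed point of \<open>\<sigma>\<close> the sign
  change already forces the value 0.\<close>

lemma sum_eq_0_by_sign_reversing_involution:
  fixes F :: "'a \<Rightarrow> 'b :: {idom, ring_char_0}"
  assumes "\<And>k. k \<in> S \<Longrightarrow> \<sigma> k \<in> S" "\<And>k. k \<in> S \<Longrightarrow> \<sigma> (\<sigma> k) = k"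
    and "\<And>k. k \<in> S \<Longrightarrow> F (\<sigma> k) = - F k"
  shows "sum F S = 0"
proof -
  have "sum F S = (\<Sum>k\<in>S. - F k)"
    by (rule sum.reindex_bij_witness[of _ \<sigma> \<sigma>]) (auto simp: assms)
  then have "sum F S + sum F S = 0" by (simp add: sum_negf eq_neg_iff_add_eq_0)
  then have "2 * sum F S = 0" by (simp only: mult_2)
  then show ?thesis by simp
qed

section \<open>Vanishing of the sum at one root of unity\<close>

context root_of_unity
begin

lemma prod_powi: "(\<Prod>i\<in>A. \<zeta> powi f i) = \<zeta> powi (\<Sum>i\<in>A. f i)"
  by (induction A rule: infinite_finite_induct) (simp_all add: power_int_add)

text \<open>Some \<open>k + s\<close> with \<open>s \<le> 2\<beta>\<close> is a multiple of
  \<open>d\<close>. It is a factor of the first Pochhammer symbol if \<open>s < \<beta>\<close>, of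
  the second if \<open>s > \<beta>\<close>, and for \<open>s = \<beta>\<close> it makes
  \<open>[2(k + \<beta>)]\<close> vanish.\<close>

lemma ev_summand_const_eq_0:
  assumes "r > 0" "k mod d = 0 \<or> k mod d + 2 * \<beta> \<ge> d"
  shows "ev \<zeta> (summand_const \<alpha> \<beta> m n r k) = 0"
proof -
  obtain s where s: "s \<le> 2 * \<beta>" "d dvd k + s"
  proof (cases "k mod d = 0")
    case True
    then show ?thesis using that[of 0] by auto
  next
    case False
    have "k mod d \<le> d" using d_gt_1 by (simp add: order_less_imp_le)
    moreover from this have "k + (d - k mod d) = d * (k div d) + d"
      using mult_div_mod_eq[of d k] by linarith
    ultimately show ?thesis using False assms(2) by (intro that[of "d - k mod d"]) auto
  qed
  consider "d dvd pochhammer k \<beta> * pochhammer (k + \<beta> + 1) \<beta>" | "d dvd 2 * (k + \<beta>)"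
  proof -
    consider "s < \<beta>" | "s = \<beta>" | "s > \<beta>" by linarith
    then show ?thesis
    proof cases
      case 1
      then show ?thesis using s that(1) dvd_pochhammer_nat[of d k s \<beta>] by simp
    next
      case 2
      then show ?thesis using s(2) that(2) by (simp only: dvd_mult)
    next
      case 3
      then have "k + \<beta> + 1 + (s - \<beta> - 1) = k + s" "s - \<beta> - 1 < \<beta>" using s by auto
      then show ?thesis
        using s that(1) dvd_pochhammer_nat[of d "k + \<beta> + 1" "s - \<beta> - 1" \<beta>] by (simp only: dvd_mult)
    qed
  qed
  then have "ev \<zeta> (qint (int (pochhammer k \<beta> * pochhammer (k + \<beta> + 1) \<beta>))) = 0
      \<or> ev \<zeta> (qint (int (2 * (k + \<beta>)))) = 0"
    unfolding ev_qint_eq_0_iff int_dvd_int_iff by cases auto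
  then show ?thesis
    unfolding summand_const_def using assms(1) by (auto simp: power_0_left)
qed

text \<open>With \<open>K = 2(k + \<beta>)\<close> and \<open>M = 2\<beta>\<alpha>m\<close>, the
  factor \<open>[K]\<close> yields \<open>-\<zeta>^-K\<close> and the power of \<open>q\<close>
  yields \<open>\<zeta>^(K(M+1))\<close>; the 1 in \<open>M + 1\<close> compensates
  \<open>\<zeta>^-K\<close>.\<close>

lemma ev_summand_const_reflect:
  assumes "d dvd n" "d dvd k + k' + 2 * \<beta>"
  shows "ev \<zeta> (summand_const \<alpha> \<beta> m n r k')
    = - (\<zeta> powi (int (2 * (k + \<beta>)) * int (2 * \<beta> * \<alpha> * m)))
      * ev \<zeta> (summand_const \<alpha> \<beta> m n r k)"
proof -
  define M where "M = int (2 * \<beta> * \<alpha> * m)"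
  define K where "K = int (2 * (k + \<beta>))"
  have M: "int (2 * \<beta> * \<alpha> * m + 1) = M + 1" by (simp add: M_def)
  have sum: "int d dvd int k + int k' + 2 * int \<beta>"
    using assms(2) by (metis int_dvd_int_iff of_nat_add of_nat_mult of_nat_numeral)
  have n: "int d dvd int n" using assms(1) by simp
  have 1: "ev \<zeta> (qint (int (pochhammer k' \<beta> * pochhammer (k' + \<beta> + 1) \<beta>)))
      = ev \<zeta> (qint (int (pochhammer k \<beta> * pochhammer (k + \<beta> + 1) \<beta>)))"
    using pochhammer_product_reflect_cong[OF assms(2)]
    by (intro ev_qint_cong) (simp only: cong_iff_dvd_diff)
  have 2: "ev \<zeta> (qint (int (2 * (k' + \<beta>)))) = - (\<zeta> powi - K) * ev \<zeta> (qint K)"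
    unfolding ev_qint_minus[symmetric]
  proof (rule ev_qint_cong)
    have "int (2 * (k' + \<beta>)) - - K = 2 * (int k + int k' + 2 * int \<beta>)" by (simp add: K_def)
    then show "int d dvd int (2 * (k' + \<beta>)) - - K" using sum by (simp only: dvd_mult)
  qed
  have 3: "\<zeta> powi ((int n - 2 * int \<beta> - int k') * (M + 1))
      = \<zeta> powi (K * (M + 1)) * \<zeta> powi ((int n - 2 * int \<beta> - int k) * (M + 1))"
    unfolding power_int_add[OF disjI1[OF nonzero], symmetric]
  proof (rule powi_cong)
    have "(int n - 2 * int \<beta> - int k') * (M + 1)
          - (K * (M + 1) + (int n - 2 * int \<beta> - int k) * (M + 1))
        = (int k + int k' + 2 * int \<beta>) * - (M + 1)"
      by (simp add: K_def algebra_simps)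
    then show "int d dvd (int n - 2 * int \<beta> - int k') * (M + 1)
          - (K * (M + 1) + (int n - 2 * int \<beta> - int k) * (M + 1))"
      using sum by (simp only: dvd_mult2)
  qed
  have 4: "\<zeta> powi - K * \<zeta> powi (K * (M + 1)) = \<zeta> powi (K * M)"
    by (simp add: algebra_simps flip: power_int_add)
  have "ev \<zeta> (summand_const \<alpha> \<beta> m n r k')
      = - (\<zeta> powi - K * \<zeta> powi (K * (M + 1))) * ev \<zeta> (summand_const \<alpha> \<beta> m n r k)"
    by (simp only: summand_const_def ev_mult[OF nonzero] ev_power[OF nonzero] ev_qpow M 1 2 3
        K_def[symmetric]) (simp add: mult_ac)
  then show ?thesis unfolding 4 by (simp only: K_def M_def)
qed

text \<open>The index \<open>k + i\<close> is reflected to \<open>k' + (2\<beta> - 1 - i)\<close>,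
  so one product is read backwards.\<close>

lemma ev_prod_w_reflect:
  assumes "\<alpha> > 0" "\<beta> > 0"
    and "k div d = k' div d" "k mod d + k' mod d + 2 * \<beta> = d" "k mod d > 0" "k' mod d > 0"
  shows "(\<Prod>i=0..2*\<beta>-1. map_poly (ev \<zeta>) (w \<alpha> (k' + i)) ^ m)
    = smult (\<zeta> powi - (int (2 * (k + \<beta>)) * int (2 * \<beta> * \<alpha> * m)))
        (\<Prod>i=0..2*\<beta>-1. map_poly (ev \<zeta>) (w \<alpha> (k + i)) ^ m)"
proof -
  let ?W = "\<lambda>k. map_poly (ev \<zeta>) (w \<alpha> k)"
  have shift: "(l + i) div d = l div d" "(l + i) mod d = l mod d + i"
    if "l mod d + i < d" for l i
  proof -
    have "l + i = l div d * d + (l mod d + i)" by simp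
    then show "(l + i) div d = l div d" "(l + i) mod d = l mod d + i"
      using that by (rule div_mod_eqI)+
  qed
  have W: "?W (k' + (2 * \<beta> - 1 - i))
      = smult (\<zeta> powi (- int \<alpha> * (2 * int (k + i) + 1))) (?W (k + i))"
    if "i \<in> {0..2*\<beta>-1}" for i
  proof -
    define j where "j = 2 * \<beta> - 1 - i"
    then have j: "2 * \<beta> - 1 - i = j" "i + j + 1 = 2 * \<beta>"
      using that assms(2) by auto
    have "k mod d + i < d" "k' mod d + j < d" using assms(4-6) j(2) by linarith+
    then show ?thesis
      unfolding j(1) using assms j(2) by (intro ev_w_reflect) (auto simp: shift)
  qed
  \<comment> \<open>For \<open>N = 2\<beta>\<close> this produces the inverse of the power of
    \<open>\<zeta>\<close> in \<open>ev_summand_const_reflect\<close>.\<close>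
  have sum: "(\<Sum>i<N. 2 * int (k + i) + 1) = int N * (2 * int k + int N)" for N
    by (induction N) (simp_all add: algebra_simps)
  have "(\<Prod>i=0..2*\<beta>-1. ?W (k' + i) ^ m) = (\<Prod>i=0..2*\<beta>-1. ?W (k' + (2 * \<beta> - 1 - i)) ^ m)"
    by (subst prod.atLeastAtMost_rev) simp
  also have "\<dots> = (\<Prod>i=0..2*\<beta>-1.
      smult (\<zeta> powi (- int \<alpha> * (2 * int (k + i) + 1) * int m)) (?W (k + i) ^ m))"
    by (intro prod.cong refl) (simp only: W smult_power power_int_power')
  also have "\<dots> = smult (\<Prod>i=0..2*\<beta>-1. \<zeta> powi (- int \<alpha> * (2 * int (k + i) + 1) * int m))
      (\<Prod>i=0..2*\<beta>-1. ?W (k + i) ^ m)"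
    by (rule prod_smult)
  also have "(\<Prod>i=0..2*\<beta>-1. \<zeta> powi (- int \<alpha> * (2 * int (k + i) + 1) * int m))
      = \<zeta> powi (- int \<alpha> * int m * (\<Sum>i<2*\<beta>. 2 * int (k + i) + 1))"
  proof -
    have "{0..2*\<beta>-1} = {..<2*\<beta>}" using assms(2) by auto
    then show ?thesis unfolding prod_powi sum_distrib_left by (simp only: mult_ac)
  qed
  also have "- int \<alpha> * int m * (\<Sum>i<2*\<beta>. 2 * int (k + i) + 1)
      = - (int (2 * (k + \<beta>)) * int (2 * \<beta> * \<alpha> * m))"
    unfolding sum by (simp add: algebra_simps)
  finally show ?thesis .
qed

lemma ev_sum_eq_0:
  assumes "\<alpha> > 0" "\<beta> > 0" "n > 0" "r > 0" "d dvd n"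
  shows "(\<Sum>k=0..n-1. smult (ev \<zeta> (summand_const \<alpha> \<beta> m n r k))
      (\<Prod>i=0..2*\<beta>-1. map_poly (ev \<zeta>) (w \<alpha> (k + i)) ^ m)) = 0" (is "sum ?F _ = 0")
proof -
  \<comment> \<open>The indices for which no \<open>k + s\<close> with
    \<open>s \<le> 2\<beta>\<close> is a multiple of \<open>d\<close>; all others contribute
    0.\<close>
  define S where "S = {k \<in> {0..n-1}. k mod d > 0 \<and> k mod d + 2 * \<beta> < d}"
  define \<sigma> where "\<sigma> k = d * (k div d) + (d - 2 * \<beta> - k mod d)" for k
  have \<sigma>: "\<sigma> k div d = k div d" "\<sigma> k mod d = d - 2 * \<beta> - k mod d" if "k \<in> S" for k
    using that d_gt_1 assms(2) div_mod_eqI[of "\<sigma> k" "k div d" d "d - 2 * \<beta> - k mod d"]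
    by (auto simp: \<sigma>_def S_def mult.commute)
  have \<sigma>_mem: "\<sigma> k \<in> S" if "k \<in> S" for k
  proof -
    have "k < n" using that assms(3) by (auto simp: S_def)
    \<comment> \<open>As \<open>d\<close> divides \<open>n\<close>, the range of summation consists
      of complete blocks of length \<open>d\<close>, and \<open>\<sigma>\<close> stays inside each
      block.\<close>
    then have "k div d < n div d"
      using assms(5) d_gt_1 by (metis dvd_div_mult_self less_mult_imp_div_less)
    then have "\<sigma> k < n" unfolding \<sigma>(1)[OF that, symmetric]
      by (metis div_le_mono leD leI)
    then show ?thesis using that \<sigma>[OF that] assms(3) by (auto simp: S_def)
  qed
  have "sum ?F {0..n-1} = sum ?F S"
    by (rule sum.mono_neutral_right)
      (use assms in \<open>auto simp: S_def not_less intro!: ev_summand_const_eq_0\<close>)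
  also have "\<dots> = 0"
  proof (rule sum_eq_0_by_sign_reversing_involution[of _ \<sigma>])
    fix k assume k: "k \<in> S"
    then have k': "k mod d + \<sigma> k mod d + 2 * \<beta> = d" "k mod d > 0" "\<sigma> k mod d > 0"
      using \<sigma>[OF k] by (auto simp: S_def)
    have "k + \<sigma> k + 2 * \<beta> = d * (2 * (k div d) + 1)"
    proof -
      have "k = d * (k div d) + k mod d" "\<sigma> k = d * (k div d) + \<sigma> k mod d"
        using \<sigma>(1)[OF k] by (simp, metis mult_div_mod_eq)
      moreover have "d * (2 * (k div d) + 1) = 2 * (d * (k div d)) + d"
        by (simp add: algebra_simps)
      ultimately show ?thesis using k'(1) by linarith
    qed
    then have "d dvd k + \<sigma> k + 2 * \<beta>" by simp
    let ?e = "int (2 * (k + \<beta>)) * int (2 * \<beta> * \<alpha> * m)"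
    \<comment> \<open>The scalars from \<open>summand_const\<close> and from the product of the
      \<open>w\<close> are inverse to each other up to sign, so only the sign survives.\<close>
    have "\<zeta> powi ?e * \<zeta> powi - ?e = 1"
      by (subst power_int_add[symmetric]) simp_all
    then show "?F (\<sigma> k) = - ?F k"
      unfolding ev_summand_const_reflect[OF assms(5) \<open>d dvd k + \<sigma> k + 2 * \<beta>\<close>]
        ev_prod_w_reflect[OF assms(1,2) \<sigma>(1)[OF k, symmetric] k']
      by (simp add: mult.commute mult.left_commute)
    show "\<sigma> k \<in> S" by (rule \<sigma>_mem[OF k])
    show "\<sigma> (\<sigma> k) = k"
      using k' \<sigma>[OF k] \<sigma>_def[of "\<sigma> k"] mult_div_mod_eq[of d k] by simp
  qed
  finally show ?thesis .
qed

end

section \<open>From nontrivial roots of unity to divisibility by \<open>[n]\<close>\<close>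

lemma root_of_unity_order_exists:
  fixes z :: complex
  assumes "n > 0" "z ^ n = 1" "z \<noteq> 1"
  obtains d where "root_of_unity z d" "d dvd n"
proof -
  \<comment> \<open>The order of \<open>z\<close>: it exists because \<open>z ^ n = 1\<close>, and
    it exceeds 1 because \<open>z\<close> is not 1.\<close>
  define d where "d = (LEAST d. d > 0 \<and> z ^ d = 1)"
  have d: "d > 0" "z ^ d = 1"
    using LeastI[of "\<lambda>d. d > 0 \<and> z ^ d = 1" n] assms by (auto simp: d_def)
  have least: "k = 0" if "k < d" "z ^ k = 1" for k
    using not_less_Least[of k "\<lambda>d. d > 0 \<and> z ^ d = 1"] that by (auto simp: d_def)
  have "z \<noteq> 0" using assms by (auto simp: power_0_left)
  have iff: "z powi e = 1 \<longleftrightarrow> int d dvd e" for e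
  proof -
    have "z powi e = z powi (int d * (e div int d) + e mod int d)" by simp
    also have "\<dots> = z powi (e mod int d)"
      using \<open>z \<noteq> 0\<close> d(2) by (subst power_int_add) (auto simp: power_int_mult)
    also have "\<dots> = z ^ nat (e mod int d)" using d(1) by (simp add: power_int_nonneg_exp)
    finally have "z powi e = z ^ nat (e mod int d)" .
    moreover have "nat (e mod int d) < d" using d(1) by (simp add: nat_less_iff)
    ultimately have "z powi e = 1 \<longleftrightarrow> nat (e mod int d) = 0" using least by (metis power_0)
    also have "\<dots> \<longleftrightarrow> int d dvd e" using d(1) by (simp add: dvd_eq_mod_eq_0 order_antisym_conv)
    finally show ?thesis .
  qed
  have "d \<noteq> 1" using d assms(3) by auto
  then have "root_of_unity z d" using d(1) iff by unfold_locales auto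
  moreover have "d dvd n" using iff[of "int n"] assms(2) by simp
  ultimately show ?thesis by (rule that)
qed

theorem theorem5:
  fixes \<alpha> \<beta> m n r :: nat
  assumes "\<alpha> > 0" and "\<beta> > 0" and "m > 0" and "n > 0" and "r > 0"
  shows "[:qint (int n):] dvd
    (\<Sum>k=0..n-1.
       [:qint (int (pochhammer k \<beta> * pochhammer (k + \<beta> + 1) \<beta>)) ^ r
         * qint (int (2 * (k + \<beta>)))
         * qpow ((int n - 2 * int \<beta> - int k) * int (2 * \<beta> * \<alpha> * m + 1)):]
       * (\<Prod>i=0..2*\<beta>-1. w \<alpha> (k + i) ^ m))"
proof (rule const_qint_dvd_if_vanishing[OF assms(4)])
  fix z :: complex assume z: "z ^ n = 1" "z \<noteq> 1"
  then obtain d where "root_of_unity z d" "d dvd n"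
    using root_of_unity_order_exists assms(4) by blast
  then interpret root_of_unity z d by simp
  show "map_poly (ev z) (\<Sum>k=0..n-1.
       [:qint (int (pochhammer k \<beta> * pochhammer (k + \<beta> + 1) \<beta>)) ^ r
         * qint (int (2 * (k + \<beta>)))
         * qpow ((int n - 2 * int \<beta> - int k) * int (2 * \<beta> * \<alpha> * m + 1)):]
       * (\<Prod>i=0..2*\<beta>-1. w \<alpha> (k + i) ^ m)) = 0"
    \<comment> \<open>Evaluation passes through sums, products and powers, and the factor free of
      \<open>x\<close> becomes a scalar.\<close>
    unfolding summand_const_def[symmetric] map_poly_ev_sum map_poly_ev_mult[OF nonzero]
      map_poly_ev_prod[OF nonzero] map_poly_ev_power[OF nonzero]
    using ev_sum_eq_0[OF assms(1,2,4,5) \<open>d dvd n\<close>] by (simp add: map_poly_pCons)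
qed

end
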